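(* Let $F$ be any finite field and let $B_1,B_2,B_3\subset F$ be any sets satisfying $|B_1||B_2||B_3|\ge 8|F|^{5/2}$. Then there exist $x,y\in F^*$ such that $x+y\in B_1$, $xy\in B_2$ and $x\in B_3$.
   Context: $F^*=F\setminus\{0\}$. *)

theory Defs
  imports Complex_Main "HOL-Library.Cardinality"
begin

end

theory Submission
  imports Defs "HOL-Analysis.Convex"
begin

text \<open>
  Put \<open>s = x + y\<close> and \<open>p = x * y\<close>, so that \<open>s = x + p / x\<close>. A solution is a pair \<open>x \<in> B3\<close>,
  \<open>p \<in> B2\<close> of nonzero elements with \<open>x + p / x \<in> B1\<close>. Let \<open>q\<close> be the size of the field and let
  \<open>b\<close> be the indicator function of \<open>B1\<close> minus its mean \<open>card B1 / q\<close>. If there is no solution,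
  then the sum of \<open>b (x + p / x)\<close> over the nonzero \<open>x \<in> B3\<close> and \<open>p \<in> B2\<close> is as negative as it
  can be, namely minus the expected number of solutions. The proof shows that there is too much
  cancellation in this sum for that to happen.

  Two applications of the Cauchy-Schwarz inequality remove the sets \<open>B2\<close> and \<open>B3\<close>
  (\<open>bilinear_sum_bound\<close>) and leave the sum, over all pairs of nonzero \<open>x\<close>, \<open>x'\<close>, of the squares of
  \<open>K(x, x') = (\<Sum>p. b (x + p / x) * b (x' + p / x'))\<close>. When \<open>p\<close> is eliminated in favour of
  \<open>s = x + p / x\<close>, the second argument \<open>x' + p / x'\<close> becomes an affine function \<open>r * s + c\<close> of
  \<open>s\<close>, where \<open>r = x / x'\<close> and \<open>c = x' - x\<^sup>2 / x'\<close>. Hence \<open>K(x, x')\<close> is the correlation of \<open>b\<close> with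
  its composition with an affine map, and apart from the pairs with \<open>x\<^sup>2 = x'\<^sup>2\<close>, different pairs
  give different affine maps.

  The second moment of such correlations over all affine maps can be computed exactly
  (\<open>sum_affine_correlation_squared\<close>): two distinct points are moved by a unique affine map to any
  two prescribed values, so the off-diagonal terms add up to a multiple of \<open>(\<Sum>s. b s)\<^sup>2 = 0\<close>, and
  the diagonal contributes \<open>q * (\<Sum>s. (b s)\<^sup>2)\<^sup>2\<close>. The at most \<open>2 * q\<close> exceptional pairs are bounded
  trivially. Without a solution this gives
  \<open>(card B1 * card B2 * card B3)\<^sup>2 \<le> 3 * q\<^sup>5\<close>, for \<open>B2\<close> and \<open>B3\<close> without zero. Removing zero at
  most halves each of these two sets, and \<open>8 / 4 = 2 > sqrt 3\<close>.
\<close>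

section \<open>Correlations along affine maps\<close>

definition affine_correlation :: "('a::{field,finite} \<Rightarrow> real) \<Rightarrow> 'a \<Rightarrow> 'a \<Rightarrow> real" where
  "affine_correlation b r c = (\<Sum>s\<in>UNIV. b s * b (r * s + c))"

text \<open>
  Linear interpolation: since constant maps (\<open>r = 0\<close>) are included, the two values may coincide.
  This is what makes the off-diagonal terms in the second moment below factor.
\<close>

lemma bij_affine_two_points:
  fixes s t :: "'a::field"
  assumes "s \<noteq> t"
  shows "bij (\<lambda>(r, c). (r * s + c, r * t + c))"
proof (rule o_bij)
  let ?g = "\<lambda>(u, v). ((u - v) / (s - t), u - (u - v) / (s - t) * s)"
  have st: "s - t \<noteq> 0" using assms by simp
  have left: "(r * s - r * t) / (s - t) = r" for r
    using st by (simp flip: right_diff_distrib)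
  show "?g \<circ> (\<lambda>(r, c). (r * s + c, r * t + c)) = id"
    by (rule ext) (simp add: case_prod_unfold left del: times_divide_eq_left)
  have right: "(u - v) / (s - t) * t + (u - (u - v) / (s - t) * s) = v" for u v
  proof -
    have "(u - v) / (s - t) * t + (u - (u - v) / (s - t) * s) = u - (u - v) / (s - t) * (s - t)"
      by (simp only: algebra_simps)
    also have "(u - v) / (s - t) * (s - t) = u - v"
      using st by (metis nonzero_eq_divide_eq)
    finally show ?thesis by (simp only: diff_diff_eq2 add_diff_cancel_left')
  qed
  show "(\<lambda>(r, c). (r * s + c, r * t + c)) \<circ> ?g = id"
    by (rule ext) (simp add: case_prod_unfold right del: times_divide_eq_left)
qed

lemma sum_affine_two_points:
  fixes b :: "'a::{field,finite} \<Rightarrow> real"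
  assumes mean: "(\<Sum>s\<in>UNIV. b s) = 0"
  shows "(\<Sum>(r, c)\<in>UNIV. b (r * s + c) * b (r * t + c)) =
    (if s = t then real CARD('a) * (\<Sum>u\<in>UNIV. (b u)\<^sup>2) else 0)"
proof (cases "s = t")
  case True
  have shift: "(\<Sum>c\<in>UNIV. (b (r * t + c))\<^sup>2) = (\<Sum>u\<in>UNIV. (b u)\<^sup>2)" for r
    by (rule sum.reindex_bij_witness[of _ "\<lambda>u. u - r * t" "\<lambda>c. r * t + c"]) auto
  have "(\<Sum>(r, c)\<in>UNIV. b (r * s + c) * b (r * t + c)) =
      (\<Sum>r\<in>UNIV. \<Sum>c\<in>UNIV. (b (r * t + c))\<^sup>2)"
    using True by (simp add: sum.cartesian_product power2_eq_square)
  with True show ?thesis by (simp add: shift)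
next
  case False
  have "(\<Sum>(r, c)\<in>UNIV. b (r * s + c) * b (r * t + c)) = (\<Sum>(u, v)\<in>UNIV. b u * b v)"
    using sum.reindex_bij_betw[OF bij_affine_two_points[OF False], of "\<lambda>(u, v). b u * b v"]
    by (simp add: case_prod_unfold)
  also have "\<dots> = (\<Sum>u\<in>UNIV. b u) * (\<Sum>v\<in>UNIV. b v)"
    by (simp add: sum_product sum.cartesian_product)
  finally show ?thesis using False mean by simp
qed

text \<open>
  Expanding the square leaves a sum over two points \<open>s\<close>, \<open>t\<close>, of which only the diagonal survives.
\<close>

lemma sum_affine_correlation_squared:
  fixes b :: "'a::{field,finite} \<Rightarrow> real"
  assumes mean: "(\<Sum>s\<in>UNIV. b s) = 0"
  shows "(\<Sum>(r, c)\<in>UNIV. (affine_correlation b r c)\<^sup>2) = real CARD('a) * (\<Sum>s\<in>UNIV. (b s)\<^sup>2)\<^sup>2"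
proof -
  let ?N = "\<Sum>u\<in>UNIV. (b u)\<^sup>2"
  have "(\<Sum>(r, c)\<in>UNIV. (affine_correlation b r c)\<^sup>2) =
      (\<Sum>z\<in>UNIV. \<Sum>s\<in>UNIV. \<Sum>t\<in>UNIV.
        b s * b t * (b (fst z * s + snd z) * b (fst z * t + snd z)))"
    by (simp add: affine_correlation_def power2_eq_square sum_product case_prod_unfold mult_ac)
  also have "\<dots> = (\<Sum>s\<in>UNIV. \<Sum>z\<in>UNIV. \<Sum>t\<in>UNIV.
        b s * b t * (b (fst z * s + snd z) * b (fst z * t + snd z)))"
    by (rule sum.swap)
  also have "\<dots> = (\<Sum>s\<in>UNIV. \<Sum>t\<in>UNIV. \<Sum>z\<in>UNIV.
        b s * b t * (b (fst z * s + snd z) * b (fst z * t + snd z)))"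
    by (intro sum.cong refl sum.swap)
  also have "\<dots> = (\<Sum>s\<in>UNIV. \<Sum>t\<in>UNIV. if s = t then b s * b t * (real CARD('a) * ?N) else 0)"
    using sum_affine_two_points[OF mean]
    by (intro sum.cong refl) (simp add: case_prod_unfold flip: sum_distrib_left)
  also have "\<dots> = (\<Sum>s\<in>UNIV. (b s)\<^sup>2 * (real CARD('a) * ?N))"
    by (simp add: power2_eq_square)
  also have "\<dots> = ?N * (real CARD('a) * ?N)"
    by (simp only: sum_distrib_right)
  finally show ?thesis by (simp add: power2_eq_square)
qed

text \<open>For injective affine maps the Cauchy-Schwarz inequality gives the trivial bound.\<close>

lemma affine_correlation_squared_le:
  fixes b :: "'a::{field,finite} \<Rightarrow> real"
  assumes "r \<noteq> 0"
  shows "(affine_correlation b r c)\<^sup>2 \<le> (\<Sum>s\<in>UNIV. (b s)\<^sup>2)\<^sup>2"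
proof -
  have "(\<Sum>s\<in>UNIV. (b (r * s + c))\<^sup>2) = (\<Sum>u\<in>UNIV. (b u)\<^sup>2)"
    using assms
    by (intro sum.reindex_bij_witness[of _ "\<lambda>u. (u - c) / r" "\<lambda>s. r * s + c"]) auto
  with Cauchy_Schwarz_ineq_sum[of b "\<lambda>s. b (r * s + c)" UNIV] show ?thesis
    by (simp add: affine_correlation_def power2_eq_square)
qed

section \<open>Cancellation along the curves of fixed product\<close>

text \<open>The substitution \<open>s = x + p / x\<close> turns the two evaluation points into \<open>s\<close> and an affine image of it.\<close>

lemma sum_product_curve_eq_affine_correlation:
  fixes b :: "'a::{field,finite} \<Rightarrow> real"
  assumes "x \<noteq> 0" "x' \<noteq> 0"
  shows "(\<Sum>p\<in>UNIV. b (x + p / x) * b (x' + p / x')) =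
    affine_correlation b (x / x') (x' - x\<^sup>2 / x')"
  unfolding affine_correlation_def
proof (rule sum.reindex_bij_witness[of _ "\<lambda>s. x * (s - x)" "\<lambda>p. x + p / x"])
  fix p
  have "x / x' * (x + p / x) + (x' - x\<^sup>2 / x') = x' + p / x'"
    using assms by (simp add: field_simps power2_eq_square)
  then show "b (x + p / x) * b (x / x' * (x + p / x) + (x' - x\<^sup>2 / x')) =
      b (x + p / x) * b (x' + p / x')"
    by (simp only:)
qed (use assms in auto)

lemma inj_on_affine_parameters:
  "inj_on (\<lambda>(x, x'). (x / x', x' - x\<^sup>2 / x')) {(x, x'). x' \<noteq> 0 \<and> x\<^sup>2 \<noteq> (x'::'a::field)\<^sup>2}"
proof (rule inj_onI, clarsimp)
  fix x x' y y' :: 'a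
  assume nz: "x' \<noteq> 0" "y' \<noteq> 0" and sq: "x\<^sup>2 \<noteq> x'\<^sup>2"
    and ratio: "x / x' = y / y'" and const: "x' - x\<^sup>2 / x' = y' - y\<^sup>2 / y'"
  define r where "r = x / x'"
  have x: "x = r * x'" using nz by (simp add: r_def)
  have y: "y = r * y'" using nz unfolding r_def ratio by simp
  \<comment> \<open>The constant term is \<open>x' * (1 - r\<^sup>2)\<close>, and the second factor vanishes only if \<open>x\<^sup>2 = x'\<^sup>2\<close>.\<close>
  have "x' * (1 - r\<^sup>2) = y' * (1 - r\<^sup>2)"
    using const nz unfolding x y by (simp add: power2_eq_square algebra_simps)
  moreover have "1 - r\<^sup>2 \<noteq> 0"
    using sq unfolding x by (auto simp: power_mult_distrib)
  ultimately have "x' = y'" by simp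
  with x y show "x = y \<and> x' = y'" by simp
qed

lemma sum_squared_product_curve_correlations_le:
  fixes b :: "'a::{field,finite} \<Rightarrow> real"
  assumes mean: "(\<Sum>s\<in>UNIV. b s) = 0"
  shows "(\<Sum>(x, x')\<in>{(x, x'). x \<noteq> 0 \<and> x' \<noteq> 0}. (\<Sum>p\<in>UNIV. b (x + p / x) * b (x' + p / x'))\<^sup>2)
    \<le> 3 * real CARD('a) * (\<Sum>s\<in>UNIV. (b s)\<^sup>2)\<^sup>2"
proof -
  let ?N = "\<Sum>s\<in>UNIV. (b s)\<^sup>2"
  let ?K = "\<lambda>(x, x'). (affine_correlation b (x / x') (x' - x\<^sup>2 / x'))\<^sup>2"
  let ?f = "\<lambda>(x, x'). (x / x', x' - x\<^sup>2 / x')"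
  define P where "P = {(x::'a, x'::'a). x \<noteq> 0 \<and> x' \<noteq> 0}"
  define G where "G = {(x::'a, x'::'a). x \<noteq> 0 \<and> x' \<noteq> 0 \<and> x\<^sup>2 \<noteq> x'\<^sup>2}"
  define E where "E = {(x::'a, x'::'a). x \<noteq> 0 \<and> x' \<noteq> 0 \<and> x\<^sup>2 = x'\<^sup>2}"
  have "(\<Sum>(x, x')\<in>P. (\<Sum>p\<in>UNIV. b (x + p / x) * b (x' + p / x'))\<^sup>2) = sum ?K P"
    by (rule sum.cong) (auto simp: P_def sum_product_curve_eq_affine_correlation)
  also have "\<dots> = sum ?K G + sum ?K E"
    by (subst sum.union_disjoint[symmetric]) (auto simp: P_def G_def E_def intro!: sum.cong)
  also have "sum ?K G \<le> real CARD('a) * ?N\<^sup>2"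
  proof -
    have inj: "inj_on ?f G"
      by (rule inj_on_subset[OF inj_on_affine_parameters]) (auto simp: G_def)
    have "sum ?K G = (\<Sum>(r, c)\<in>?f ` G. (affine_correlation b r c)\<^sup>2)"
      by (subst sum.reindex[OF inj]) (auto intro!: sum.cong)
    also have "\<dots> \<le> (\<Sum>(r, c)\<in>UNIV. (affine_correlation b r c)\<^sup>2)"
      by (rule sum_mono2) auto
    finally show ?thesis using sum_affine_correlation_squared[OF mean] by simp
  qed
  also have "sum ?K E \<le> (2 * real CARD('a)) * ?N\<^sup>2"
  proof -
    have "E \<subseteq> (\<lambda>x. (x, x)) ` UNIV \<union> (\<lambda>x. (x, - x)) ` UNIV"
      by (auto simp: E_def power2_eq_iff image_iff)
    then have "card E \<le> card (range (\<lambda>x::'a. (x, x)) \<union> range (\<lambda>x. (x, - x)))"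
      by (intro card_mono) auto
    also have "\<dots> \<le> CARD('a) + CARD('a)"
      by (rule order_trans[OF card_Un_le]) (intro add_mono card_image_le finite)
    finally have card: "real (card E) \<le> 2 * real CARD('a)" by linarith
    have "sum ?K E \<le> real (card E) * ?N\<^sup>2"
      by (rule sum_bounded_above) (auto simp: E_def intro!: affine_correlation_squared_le)
    also have "\<dots> \<le> (2 * real CARD('a)) * ?N\<^sup>2"
      using card by (rule mult_right_mono) simp
    finally show ?thesis .
  qed
  finally show ?thesis by (simp add: P_def)
qed

text \<open>
  The Cauchy-Schwarz inequality is applied to the sum over \<open>p\<close>, which is then extended from \<open>P\<close> to
  the whole field, and after that in the same way to the sum over the pairs \<open>(x, x')\<close>. Both
  extensions only add squares. They lose the structure of \<open>P\<close> and \<open>X\<close>, but make the correlations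
  of \<open>b\<close> appear.
\<close>

lemma bilinear_sum_bound:
  fixes b :: "'a::{field,finite} \<Rightarrow> real"
  assumes mean: "(\<Sum>s\<in>UNIV. b s) = 0" and "0 \<notin> X"
  shows "(\<Sum>p\<in>P. \<Sum>x\<in>X. b (x + p / x)) ^ 4
    \<le> (real (card P) * real (card X))\<^sup>2 * (3 * real CARD('a) * (\<Sum>s\<in>UNIV. (b s)\<^sup>2)\<^sup>2)"
proof -
  let ?K = "\<lambda>(x, x'). \<Sum>p\<in>UNIV. b (x + p / x) * b (x' + p / x')"
  let ?T = "\<Sum>p\<in>P. \<Sum>x\<in>X. b (x + p / x)"
  define S where "S = sum ?K (X \<times> X)"
  have "?T\<^sup>2 \<le> (\<Sum>p\<in>P. (\<Sum>x\<in>X. b (x + p / x))\<^sup>2) * real (card P)"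
    by (rule sum_squared_le_sum_of_squares)
  also have "\<dots> \<le> (\<Sum>p\<in>UNIV. (\<Sum>x\<in>X. b (x + p / x))\<^sup>2) * real (card P)"
    by (intro mult_right_mono sum_mono2) auto
  also have "(\<Sum>p\<in>UNIV. (\<Sum>x\<in>X. b (x + p / x))\<^sup>2) = S"
  proof -
    have "(\<Sum>p\<in>UNIV. (\<Sum>x\<in>X. b (x + p / x))\<^sup>2) =
        (\<Sum>p\<in>UNIV. \<Sum>z\<in>X \<times> X. b (fst z + p / fst z) * b (snd z + p / snd z))"
      by (simp add: power2_eq_square sum_product sum.cartesian_product case_prod_unfold)
    also have "\<dots> = S"
      unfolding S_def case_prod_unfold by (rule sum.swap)
    finally show ?thesis .
  qed
  finally have first: "?T\<^sup>2 \<le> S * real (card P)" .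
  have "S\<^sup>2 \<le> (\<Sum>z\<in>X \<times> X. (?K z)\<^sup>2) * real (card (X \<times> X))"
    unfolding S_def by (rule sum_squared_le_sum_of_squares)
  also have "(\<Sum>z\<in>X \<times> X. (?K z)\<^sup>2) \<le> (\<Sum>z\<in>{(x, x'). x \<noteq> 0 \<and> x' \<noteq> 0}. (?K z)\<^sup>2)"
    using \<open>0 \<notin> X\<close> by (intro sum_mono2) auto
  also have "\<dots> \<le> 3 * real CARD('a) * (\<Sum>s\<in>UNIV. (b s)\<^sup>2)\<^sup>2"
    using sum_squared_product_curve_correlations_le[OF mean] by (simp add: case_prod_unfold)
  finally have second:
    "S\<^sup>2 \<le> 3 * real CARD('a) * (\<Sum>s\<in>UNIV. (b s)\<^sup>2)\<^sup>2 * (real (card X))\<^sup>2"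
    by (simp add: card_cartesian_product power2_eq_square mult_right_mono)
  have "?T ^ 4 = (?T\<^sup>2)\<^sup>2" by simp
  also have "\<dots> \<le> (S * real (card P))\<^sup>2"
    using first by (intro power_mono) auto
  also have "\<dots> = S\<^sup>2 * (real (card P))\<^sup>2"
    by (rule power_mult_distrib)
  also have "\<dots> \<le> (3 * real CARD('a) * (\<Sum>s\<in>UNIV. (b s)\<^sup>2)\<^sup>2 * (real (card X))\<^sup>2) * (real (card P))\<^sup>2"
    using second by (rule mult_right_mono) simp
  finally show ?thesis by (simp add: power_mult_distrib mult_ac)
qed

section \<open>Sets without a solution\<close>

lemma no_solution_card_bound:
  fixes A P X :: "'a::{field,finite} set"
  assumes no_sol: "\<And>x p. x \<in> X \<Longrightarrow> p \<in> P \<Longrightarrow> x + p / x \<notin> A" and "0 \<notin> X"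
  shows "(real (card A) * real (card P) * real (card X))\<^sup>2 \<le> 3 * real CARD('a) ^ 5"
proof (cases "card A * card P * card X = 0")
  case True
  then show ?thesis by auto
next
  case False
  define q a M where "q = real CARD('a)" and "a = real (card A)"
    and "M = real (card P) * real (card X)"
  have pos: "q > 0" "a > 0" "M > 0"
    using False by (simp_all add: q_def a_def M_def zero_less_mult_iff card_gt_0_iff)
  define b where "b s = (if s \<in> A then 1 else 0) - a / q" for s
  have mean: "(\<Sum>s\<in>UNIV. b s) = 0"
    using pos by (simp add: b_def sum_subtractf a_def q_def flip: sum.inter_filter)
  have "(\<Sum>s\<in>UNIV. (b s)\<^sup>2) = (\<Sum>s\<in>UNIV. (if s \<in> A then b s else 0) - a / q * b s)"
    by (rule sum.cong) (auto simp: b_def power2_eq_square algebra_simps)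
  also have "\<dots> = (\<Sum>s\<in>A. b s)"
    using mean by (simp add: sum_subtractf flip: sum_distrib_left sum_divide_distrib sum.inter_filter)
  also have "\<dots> \<le> a"
    using pos by (simp add: b_def a_def)
  finally have norm: "(\<Sum>s\<in>UNIV. (b s)\<^sup>2) \<le> a" .
  have "(\<Sum>p\<in>P. \<Sum>x\<in>X. b (x + p / x)) = (\<Sum>p\<in>P. \<Sum>x\<in>X. - (a / q))"
    by (intro sum.cong refl) (simp add: b_def no_sol)
  also have "\<dots> = - (a / q * M)" by (simp add: M_def)
  finally have "(a / q * M) ^ 4 = (\<Sum>p\<in>P. \<Sum>x\<in>X. b (x + p / x)) ^ 4" by simp
  also have "\<dots> \<le> M\<^sup>2 * (3 * q * (\<Sum>s\<in>UNIV. (b s)\<^sup>2)\<^sup>2)"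
    using bilinear_sum_bound[OF mean \<open>0 \<notin> X\<close>] by (simp add: M_def q_def)
  also have "\<dots> \<le> M\<^sup>2 * (3 * q * a\<^sup>2)"
    using norm pos by (intro mult_left_mono power_mono) (auto intro: sum_nonneg)
  finally have "(a * M) ^ 4 \<le> M\<^sup>2 * (3 * q * a\<^sup>2) * q ^ 4"
    using pos by (simp add: power_mult_distrib power_divide field_simps)
  then have "(a * M)\<^sup>2 * (a * M)\<^sup>2 \<le> (a * M)\<^sup>2 * (3 * q ^ 5)"
    by (simp add: power_mult_distrib eval_nat_numeral mult_ac)
  moreover have "(a * M)\<^sup>2 > 0" using pos by simp
  ultimately have "(a * M)\<^sup>2 \<le> 3 * q ^ 5"
    by (rule mult_left_le_imp_le)
  then show ?thesis by (simp add: a_def M_def q_def mult.assoc)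
qed

theorem theorem1p18:
  fixes B1 B2 B3 :: "'F :: {field, finite} set"
  assumes "real (card B1) * real (card B2) * real (card B3) \<ge> 8 * real CARD('F) powr (5 / 2)"
  shows "\<exists>x y :: 'F. x \<noteq> 0 \<and> y \<noteq> 0 \<and> x + y \<in> B1 \<and> x * y \<in> B2 \<and> x \<in> B3"
proof (rule ccontr)
  assume no_sol: "\<not> ?thesis"
  define q b1 b2 b3 where "q = real CARD('F)" and "b1 = real (card B1)"
    and "b2 = real (card B2)" and "b3 = real (card B3)"
  have q: "q \<ge> 1" by (simp add: q_def Suc_le_eq)
  have le_q: "b1 \<le> q" "b2 \<le> q" "b3 \<le> q"
    by (auto simp: b1_def b2_def b3_def q_def intro!: card_mono)
  have nonneg: "b1 \<ge> 0" "b2 \<ge> 0" "b3 \<ge> 0"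
    by (auto simp: b1_def b2_def b3_def)
  have big: "8 * q powr (5 / 2) \<le> b1 * b2 * b3"
    using assms by (simp add: q_def b1_def b2_def b3_def)
  have q2: "q\<^sup>2 \<le> q powr (5 / 2)"
    using q powr_mono[of 2 "5 / 2" q] by simp
  \<comment> \<open>No set has more than \<open>q\<close> elements, so \<open>B2\<close> and \<open>B3\<close> have at least \<open>8\<close> each, and
    removing zero costs at most half of them.\<close>
  have "8 * q\<^sup>2 \<le> b2 * q\<^sup>2"
  proof -
    have "b1 * b2 * b3 \<le> q * b2 * q"
      using le_q nonneg q by (intro mult_mono) auto
    then show ?thesis using big q2 by (simp add: power2_eq_square mult_ac)
  qed
  then have b2: "b2 \<ge> 8" using q by simp
  have "8 * q\<^sup>2 \<le> b3 * q\<^sup>2"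
  proof -
    have "b1 * b2 * b3 \<le> q * q * b3"
      using le_q nonneg q by (intro mult_mono) auto
    then show ?thesis using big q2 by (simp add: power2_eq_square mult_ac)
  qed
  then have b3: "b3 \<ge> 8" using q by simp
  have half2: "b2 / 2 \<le> real (card (B2 - {0}))" and half3: "b3 / 2 \<le> real (card (B3 - {0}))"
    using b2 b3 by (auto simp: b2_def b3_def card_Diff_singleton_if)
  have "2 * q powr (5 / 2) \<le> b1 * (b2 / 2) * (b3 / 2)" using big by simp
  also have "\<dots> \<le> b1 * real (card (B2 - {0})) * real (card (B3 - {0}))"
    using half2 half3 nonneg by (intro mult_mono) auto
  finally have "(2 * q powr (5 / 2))\<^sup>2 \<le> (b1 * real (card (B2 - {0})) * real (card (B3 - {0})))\<^sup>2"
    by (intro power_mono) auto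
  also have "\<dots> \<le> 3 * q ^ 5"
    unfolding q_def b1_def
  proof (rule no_solution_card_bound)
    fix x p assume "x \<in> B3 - {0}" "p \<in> B2 - {0}"
    then have "x \<noteq> 0" "p / x \<noteq> 0" "x * (p / x) \<in> B2" "x \<in> B3" by auto
    with no_sol show "x + p / x \<notin> B1" by blast
  qed simp
  finally have "(2 * q powr (5 / 2))\<^sup>2 \<le> 3 * q ^ 5" .
  moreover have "(q powr (5 / 2))\<^sup>2 = q ^ 5"
    using q by (simp add: powr_power)
  ultimately have "4 * q ^ 5 \<le> 3 * q ^ 5"
    by (simp add: power_mult_distrib)
  moreover have "q ^ 5 > 0" using q by simp
  ultimately show False by simp
qed

end
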